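(* Let $n\ge 1$ and $1\le j\le n$. The number of weakly-decreasing parking functions of $1,\ldots,n$ for which the $j$-th spot is lucky, and likewise the number for which the $j$-th car is lucky, is \[ \sum_{k=0}^{n-j}C_{n-1-k}C_k=\sum_{k=0}^{n-j}\frac1{(n-k)(k+1)}\binom{2(n-1-k)}{n-1-k}\binom{2k}{k}. \]
   Context: There are $n$ spots labeled $1,\ldots,n$ in order along a one-way street, and $n$ cars entering one after another, car $i$ having preference $a_i\in\{1,\ldots,n\}$. Each car drives to its preferred spot and parks there if it is available; otherwise it moves forward and parks in the first available later spot, if any (if none, it fails to park). A parking function of $1,\ldots,n$ is a sequence of preferences $(a_1,\ldots,a_n)$ such that all $n$ cars are able to park; it is weakly-decreasing if $a_1\ge a_2\ge\cdots\ge a_n$. A car is lucky if it parks in its preferred spot; a spot is lucky if the car that parks in it prefers that spot. $C_m=\frac1{m+1}\binom{2m}{m}$ is the $m$-th Catalan number. *)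

theory Defs
  imports Complex_Main
begin

text \<open>
  A preference sequence is a list \<open>as\<close> of spots; spots and cars are numbered from 1, so
  the preference of car \<open>i\<close> is \<open>as ! (i - 1)\<close>.
\<close>

definition park_spot :: "nat \<Rightarrow> nat set \<Rightarrow> nat \<Rightarrow> nat option" where
  "park_spot n occ a =
     (if \<exists>s. a \<le> s \<and> s \<le> n \<and> s \<notin> occ
      then Some (LEAST s. a \<le> s \<and> s \<le> n \<and> s \<notin> occ)
      else None)"

text \<open>
  The entries of the result are the spots taken by the successive cars, \<open>None\<close> standing for
  a car that fails to park; \<open>occ\<close> is the set of spots already occupied.
\<close>

primrec park :: "nat \<Rightarrow> nat set \<Rightarrow> nat list \<Rightarrow> nat option list" where
  "park n occ [] = []"
| "park n occ (a # as) =
     park_spot n occ a # park n (occ \<union> set_option (park_spot n occ a)) as"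

definition parking_function :: "nat \<Rightarrow> nat list \<Rightarrow> bool" where
  "parking_function n as \<longleftrightarrow>
     length as = n \<and> set as \<subseteq> {1..n} \<and> None \<notin> set (park n {} as)"

definition weakly_decreasing :: "nat list \<Rightarrow> bool" where
  "weakly_decreasing as \<longleftrightarrow> sorted_wrt (\<ge>) as"

definition lucky_car :: "nat \<Rightarrow> nat list \<Rightarrow> nat \<Rightarrow> bool" where
  "lucky_car n as i \<longleftrightarrow> park n {} as ! (i - 1) = Some (as ! (i - 1))"

definition lucky_spot :: "nat \<Rightarrow> nat list \<Rightarrow> nat \<Rightarrow> bool" where
  "lucky_spot n as s \<longleftrightarrow>
     (\<exists>i\<in>{1..length as}. park n {} as ! (i - 1) = Some s \<and> as ! (i - 1) = s)"

definition catalan :: "nat \<Rightarrow> real" where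
  "catalan m = 1 / (real m + 1) * real ((2 * m) choose m)"

end

theory Submission
  imports Defs
begin

text \<open>
  Weakly decreasing parking functions are Young diagrams inside a staircase. In one of them
  a spot is lucky iff it is preferred by some car, and a car is lucky iff it is the first
  one with its preference; conjugation of diagrams exchanges the two conditions.

  Let \<open>f j\<close> be the number of diagrams in which the value \<open>j\<close> occurs. Turning the entries
  \<open>j + 1\<close> into \<open>j\<close> injects the diagrams with \<open>j + 1\<close> but without \<open>j\<close> into those with \<open>j\<close> but
  without \<open>j + 1\<close>. The ones missed touch the staircase at level \<open>j\<close> and split there into
  two independent staircase diagrams of sizes \<open>n - j\<close> and \<open>j - 1\<close>, so
  \<open>f j = f (j + 1) + C\<^sub>n\<^sub>-\<^sub>j C\<^sub>j\<^sub>-\<^sub>1\<close>, which telescopes because \<open>f (n + 1) = 0\<close>.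
\<close>

section \<open>Diagrams inside a staircase\<close>

text \<open>Subtracting 1 from every entry gives a partition inside the staircase
  \<open>(n - 1, ..., 1, 0)\<close>. Positions count from 0, so the bound lets car
  \<open>i + 1\<close> prefer spots up to \<open>n - i\<close>.\<close>

definition staircase :: "nat \<Rightarrow> nat list set" where
  "staircase n = {as. length as = n \<and> sorted_wrt (\<ge>) as \<and> (\<forall>i<n. 1 \<le> as ! i \<and> as ! i + i \<le> n)}"

lemma staircase_nth_mono:
  assumes "as \<in> staircase n" "i \<le> k" "k < n"
  shows "as ! k \<le> as ! i"
  using assms by (cases "i = k") (auto simp: staircase_def sorted_wrt_iff_nth_less)

lemma staircase_nth_bounds:
  assumes "as \<in> staircase n" "i < n"
  shows "1 \<le> as ! i" "as ! i + i \<le> n"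
  using assms unfolding staircase_def by blast+

lemma staircase_set: "as \<in> staircase n \<Longrightarrow> set as \<subseteq> {1..n}"
  by (fastforce simp: staircase_def in_set_conv_nth)

lemma finite_staircase [simp]: "finite (staircase n)"
proof (rule finite_subset)
  show "staircase n \<subseteq> {as. set as \<subseteq> {1..n} \<and> length as = n}"
    using staircase_set by (auto simp: staircase_def)
qed (simp add: finite_lists_length_eq)

lemma Cons_in_staircase_iff:
  "a # as \<in> staircase (Suc n) \<longleftrightarrow>
     as \<in> staircase n \<and> 1 \<le> a \<and> a \<le> Suc n \<and> (\<forall>x\<in>set as. x \<le> a)"
  by (auto simp: staircase_def All_less_Suc2)


section \<open>Parking in weakly decreasing order\<close>

lemma park_spot_SomeD:
  assumes "park_spot n occ a = Some s"
  shows "a \<le> s" "s \<le> n" "s \<notin> occ" "\<And>t. a \<le> t \<Longrightarrow> t < s \<Longrightarrow> t \<in> occ"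
proof -
  let ?P = "\<lambda>s. a \<le> s \<and> s \<le> n \<and> s \<notin> occ"
  have ex: "\<exists>s. ?P s" and s: "s = (LEAST s. ?P s)"
    using assms by (auto simp: park_spot_def split: if_splits)
  have "?P s" unfolding s using ex by (rule LeastI_ex)
  then show *: "a \<le> s" "s \<le> n" "s \<notin> occ" by auto
  show "t \<in> occ" if "a \<le> t" "t < s" for t
    using not_less_Least[of t ?P] that * s by auto
qed

lemma park_spot_None_iff: "park_spot n occ a = None \<longleftrightarrow> {a..n} \<subseteq> occ"
  by (auto simp: park_spot_def)

lemma park_spot_free: "a \<le> n \<Longrightarrow> a \<notin> occ \<Longrightarrow> park_spot n occ a = Some a"
  by (auto simp: park_spot_def intro!: Least_equality)

text \<open>As preferences decrease, every occupied spot stays at or after all preferences still to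
  come. So a car with preference \<open>a\<close> finds a place iff \<open>occ\<close> does not fill
  \<open>{a..n}\<close>, that is iff \<open>a + card occ \<le> n\<close>; parking then raises
  \<open>card occ\<close> by one.\<close>

lemma all_park_iff:
  assumes "sorted_wrt (\<ge>) as" "set as \<subseteq> {1..n}" "\<And>a. a \<in> set as \<Longrightarrow> occ \<subseteq> {a..n}"
  shows "None \<notin> set (park n occ as) \<longleftrightarrow> (\<forall>i<length as. as ! i + i + card occ \<le> n)"
  using assms
proof (induction as arbitrary: occ)
  case (Cons a as)
  have occ: "occ \<subseteq> {a..n}" and a: "1 \<le> a" "a \<le> n" using Cons.prems by auto
  have fin: "finite occ" using occ finite_subset by blast
  show ?case
  proof (cases "park_spot n occ a")
    case None
    then have "occ = {a..n}" using occ by (auto simp: park_spot_None_iff)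
    then have "card occ = Suc n - a" by simp
    then have "\<not> a + card occ \<le> n" using a by simp
    then show ?thesis using None by (auto simp: All_less_Suc2)
  next
    case (Some s)
    note s = park_spot_SomeD[OF Some]
    have "card occ < card {a..n}"
      using s occ by (intro psubset_card_mono) auto
    then have 1: "a + card occ \<le> n" using a by simp
    have 2: "card (insert s occ) = Suc (card occ)" using fin s by simp
    have "None \<notin> set (park n (insert s occ) as) \<longleftrightarrow>
        (\<forall>i<length as. as ! i + i + card (insert s occ) \<le> n)"
    proof (rule Cons.IH)
      fix b assume "b \<in> set as"
      then have "occ \<subseteq> {b..n}" "b \<le> a" using Cons.prems by auto
      then show "insert s occ \<subseteq> {b..n}" using s by simp
    qed (use Cons.prems in simp_all)
    then show ?thesis using Some 1 2 by (simp add: All_less_Suc2)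
  qed
qed simp

text \<open>After the turn of a car with preference \<open>a\<close>, spot \<open>a\<close> is
  occupied and no spot below \<open>a\<close> has changed, whether the car parked at
  \<open>a\<close>, further on or not at all. Later preferences are at most \<open>a\<close>, so a
  car finds its spot taken iff the spot lay in \<open>occ\<close> or an earlier car preferred
  it.\<close>

lemma park_lucky_iff:
  assumes "sorted_wrt (\<ge>) as" "set as \<subseteq> {1..n}" "i < length as"
  shows "park n occ as ! i = Some (as ! i) \<longleftrightarrow> as ! i \<notin> occ \<and> (\<forall>k<i. as ! k \<noteq> as ! i)"
  using assms
proof (induction as arbitrary: occ i)
  case (Cons a as)
  show ?case
  proof (cases i)
    case 0
    then show ?thesis
      using Cons.prems park_spot_free[of a n occ] park_spot_SomeD(3)[of n occ a a] by auto
  next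
    case (Suc k)
    let ?b = "as ! k" and ?occ = "occ \<union> set_option (park_spot n occ a)"
    have k: "k < length as" using Cons.prems Suc by simp
    then have b: "?b \<le> a" "a \<le> n" using Cons.prems by auto
    have "?b \<in> ?occ \<longleftrightarrow> ?b \<in> occ \<or> a = ?b"
    proof (cases "park_spot n occ a")
      case None
      moreover have "{a..n} \<subseteq> occ" using None by (simp add: park_spot_None_iff)
      ultimately show ?thesis using b by auto
    next
      case (Some s)
      then show ?thesis using b park_spot_SomeD[OF Some] by (cases "a = s") auto
    qed
    moreover have "park n ?occ as ! k = Some ?b \<longleftrightarrow> ?b \<notin> ?occ \<and> (\<forall>l<k. as ! l \<noteq> ?b)"
      using Cons.prems k by (intro Cons.IH) auto
    ultimately show ?thesis using Suc by (auto simp: All_less_Suc2)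
  qed
qed simp

lemma decreasing_parking_function_iff:
  "parking_function n as \<and> weakly_decreasing as \<longleftrightarrow> as \<in> staircase n"
proof -
  have "None \<notin> set (park n {} as) \<longleftrightarrow> (\<forall>i<n. as ! i + i \<le> n)"
    if "length as = n" "set as \<subseteq> {1..n}" "sorted_wrt (\<ge>) as"
    using all_park_iff[of as n "{}"] that by simp
  moreover have "\<forall>i<n. 1 \<le> as ! i" if "length as = n" "set as \<subseteq> {1..n}"
    using that by (metis atLeastAtMost_iff nth_mem subsetD)
  ultimately show ?thesis
    using staircase_set[of as n]
    unfolding parking_function_def weakly_decreasing_def staircase_def by blast
qed

lemma lucky_car_iff:
  assumes "as \<in> staircase n" "i < n"
  shows "lucky_car n as (Suc i) \<longleftrightarrow> (\<forall>k<i. as ! k \<noteq> as ! i)"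
  using park_lucky_iff[of as n i "{}"] assms staircase_set[of as n]
  by (simp add: lucky_car_def staircase_def)

text \<open>The first of the cars that prefer \<open>s\<close> is lucky and so parks in
  \<open>s\<close>.\<close>

lemma lucky_spot_iff:
  assumes "as \<in> staircase n"
  shows "lucky_spot n as s \<longleftrightarrow> s \<in> set as"
proof
  assume "s \<in> set as"
  define i where "i = (LEAST i. i < n \<and> as ! i = s)"
  have "\<exists>i. i < n \<and> as ! i = s"
    using \<open>s \<in> set as\<close> assms by (auto simp: in_set_conv_nth staircase_def)
  then have i: "i < n \<and> as ! i = s" unfolding i_def by (rule LeastI_ex)
  have "as ! k \<noteq> as ! i" if "k < i" for k
    using not_less_Least[of k "\<lambda>i. i < n \<and> as ! i = s"] that i by (auto simp: i_def)
  then have "lucky_car n as (Suc i)" using lucky_car_iff assms i by blast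
  then show "lucky_spot n as s"
    using i assms by (auto simp: lucky_spot_def lucky_car_def staircase_def intro!: bexI[of _ "Suc i"])
next
  assume "lucky_spot n as s"
  then show "s \<in> set as" unfolding lucky_spot_def by force
qed


section \<open>Conjugation\<close>

text \<open>
  Up to the shift by one between parts and preferences this is the conjugate partition.
\<close>

definition conjugate :: "nat \<Rightarrow> nat list \<Rightarrow> nat list" where
  "conjugate n as = map (\<lambda>k. Suc (card {i. i < n \<and> Suc k < as ! i})) [0..<n]"

lemma length_conjugate [simp]: "length (conjugate n as) = n"
  by (simp add: conjugate_def)

lemma nth_conjugate:
  "k < n \<Longrightarrow> conjugate n as ! k = Suc (card {i. i < n \<and> Suc k < as ! i})"
  by (simp add: conjugate_def)

text \<open>Entries decrease, so the positions with an entry above \<open>v\<close> form an initial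
  segment, which is determined by its cardinality.\<close>

lemma card_nth_greater_iff:
  assumes "as \<in> staircase n" "i < n"
  shows "i < card {i. i < n \<and> v < as ! i} \<longleftrightarrow> v < as ! i"
proof
  assume "v < as ! i"
  then have "{..i} \<subseteq> {i. i < n \<and> v < as ! i}"
    using staircase_nth_mono[OF assms(1) _ assms(2)] assms(2) by (auto intro: less_le_trans)
  then show "i < card {i. i < n \<and> v < as ! i}"
    using card_mono[of "{i. i < n \<and> v < as ! i}" "{..i}"] by simp
next
  assume *: "i < card {i. i < n \<and> v < as ! i}"
  show "v < as ! i"
  proof (rule ccontr)
    assume "\<not> v < as ! i"
    then have "{i. i < n \<and> v < as ! i} \<subseteq> {..<i}"
      using staircase_nth_mono[OF assms(1), of i] by (auto simp: not_less) (meson not_le le_trans)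
    then show False
      using card_mono[of "{..<i}" "{i. i < n \<and> v < as ! i}"] * by simp
  qed
qed

text \<open>The staircase is self-conjugate: \<open>Suc k < as ! i\<close> and
  \<open>as ! i + i \<le> n\<close> force \<open>i < n - Suc k\<close>.\<close>

lemma conjugate_in_staircase:
  assumes "as \<in> staircase n"
  shows "conjugate n as \<in> staircase n"
proof -
  have "Suc (card {i. i < n \<and> Suc k < as ! i}) + k \<le> n" if "k < n" for k
  proof -
    have "{i. i < n \<and> Suc k < as ! i} \<subseteq> {..<n - Suc k}"
      using assms by (fastforce simp: staircase_def)
    then show ?thesis
      using card_mono[of "{..<n - Suc k}" "{i. i < n \<and> Suc k < as ! i}"] that by simp
  qed
  moreover have "card {i. i < n \<and> Suc l < as ! i} \<le> card {i. i < n \<and> Suc k < as ! i}"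
    if "k < l" for k l
    using that by (intro card_mono) auto
  ultimately show ?thesis
    by (auto simp: staircase_def conjugate_def sorted_wrt_iff_nth_less)
qed

text \<open>Cells are transposed: \<open>Suc i < conjugate n as ! k\<close> iff
  \<open>Suc k < as ! i\<close>. Exactly \<open>as ! i - 1\<close> values of \<open>k\<close>
  satisfy the latter.\<close>

lemma conjugate_conjugate:
  assumes "as \<in> staircase n"
  shows "conjugate n (conjugate n as) = as"
proof (rule nth_equalityI)
  show "length (conjugate n (conjugate n as)) = length as"
    using assms by (simp add: conjugate_def staircase_def)
next
  fix i assume "i < length (conjugate n (conjugate n as))"
  then have i: "i < n" by (simp add: conjugate_def)
  have b: "1 \<le> as ! i" "as ! i \<le> n" using staircase_nth_bounds[OF assms i] by simp_all
  have "{k. k < n \<and> Suc i < conjugate n as ! k} = {k. k < n \<and> Suc k < as ! i}"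
    by (intro Collect_cong conj_cong refl) (simp add: nth_conjugate card_nth_greater_iff[OF assms i])
  also have "\<dots> = {..<as ! i - 1}" using b by auto
  finally show "conjugate n (conjugate n as) ! i = as ! i"
    using i b by (simp add: nth_conjugate)
qed

text \<open>The value \<open>Suc m\<close> occurs iff exactly \<open>m\<close> entries exceed some
  threshold \<open>Suc k\<close>. These are the first \<open>m\<close> entries, so the threshold
  separates \<open>as ! m\<close> from all of them. Conversely \<open>as ! m\<close> itself is such
  a threshold, at index \<open>as ! m - 1\<close>.\<close>

lemma mem_conjugate_iff:
  assumes "as \<in> staircase n" "m < n"
  shows "Suc m \<in> set (conjugate n as) \<longleftrightarrow> (\<forall>k<m. as ! k \<noteq> as ! m)"
proof
  assume "Suc m \<in> set (conjugate n as)"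
  then obtain k where k: "card {i. i < n \<and> Suc k < as ! i} = m"
    by (auto simp: conjugate_def)
  have "\<not> Suc k < as ! m" using card_nth_greater_iff[OF assms, of "Suc k"] k by simp
  moreover have "Suc k < as ! l" if "l < m" for l
    using card_nth_greater_iff[OF assms(1), of l "Suc k"] k that assms(2) by simp
  ultimately show "\<forall>k<m. as ! k \<noteq> as ! m" by metis
next
  assume *: "\<forall>k<m. as ! k \<noteq> as ! m"
  have "{i. i < n \<and> as ! m < as ! i} = {..<m}"
  proof (intro equalityI subsetI)
    fix i assume "i \<in> {..<m}"
    then show "i \<in> {i. i < n \<and> as ! m < as ! i}"
      using * staircase_nth_mono[OF assms(1), of i m] assms(2) by (auto simp: le_less)
  next
    fix i assume "i \<in> {i. i < n \<and> as ! m < as ! i}"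
    then show "i \<in> {..<m}"
      using staircase_nth_mono[OF assms(1), of m i] by (auto simp: not_le[symmetric])
  qed
  moreover have "1 \<le> as ! m" "as ! m \<le> n"
    using staircase_nth_bounds[OF assms] by simp_all
  ultimately have "conjugate n as ! (as ! m - 1) = Suc m" "as ! m - 1 < length (conjugate n as)"
    by (simp_all add: nth_conjugate)
  then show "Suc m \<in> set (conjugate n as)" by (metis nth_mem)
qed

lemma card_lucky_car_eq_card_mem:
  assumes "1 \<le> j" "j \<le> n"
  shows "card {as \<in> staircase n. lucky_car n as j} = card {as \<in> staircase n. j \<in> set as}"
proof -
  obtain m where m: "j = Suc m" "m < n" using assms by (cases j) auto
  have iff: "lucky_car n as j \<longleftrightarrow> j \<in> set (conjugate n as)" if "as \<in> staircase n" for as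
    using lucky_car_iff[OF that m(2)] mem_conjugate_iff[OF that m(2)] m(1) by simp
  have "bij_betw (conjugate n) {as \<in> staircase n. lucky_car n as j} {as \<in> staircase n. j \<in> set as}"
    by (rule bij_betw_byWitness[where f' = "conjugate n"])
      (auto simp: conjugate_conjugate conjugate_in_staircase iff)
  then show ?thesis by (rule bij_betw_same_card)
qed


section \<open>The Catalan count\<close>

text \<open>
  The ballot numbers: the largest entry is either at most \<open>h\<close>, or it is the leading entry
  \<open>h + 1\<close>, which can be removed.
\<close>

lemma card_staircase_bounded:
  "h \<le> n \<Longrightarrow> card {as \<in> staircase n. \<forall>x\<in>set as. x \<le> Suc h} + ((n + h) choose Suc n)
     = (n + h) choose n"
proof (induction "n + h" arbitrary: n h)
  case 0
  have "{as \<in> staircase 0. \<forall>x\<in>set as. x \<le> Suc 0} = {[]}"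
    by (auto simp: staircase_def)
  moreover have "n = 0" "h = 0" using 0(1) by simp_all
  ultimately show ?case by simp
next
  case (Suc s)
  then obtain n' where n: "n = Suc n'" by (cases n) auto
  let ?B = "\<lambda>n h. {as \<in> staircase n. \<forall>x\<in>set as. x \<le> h}"
  show ?case
  proof (cases h)
    case 0
    have "as = replicate n 1" if "as \<in> ?B n 1" for as
    proof (rule replicate_eqI)
      show "length as = n" using that by (simp add: staircase_def)
      show "y = 1" if "y \<in> set as" for y
        using that \<open>as \<in> ?B n 1\<close> staircase_set[of as n] by fastforce
    qed
    moreover have "replicate n 1 \<in> ?B n 1" by (auto simp: staircase_def sorted_wrt_iff_nth_less)
    ultimately have "?B n 1 = {replicate n 1}" by blast
    then show ?thesis using 0 by simp
  next
    case (Suc h')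
    have split: "?B n (Suc h) = ?B n h \<union> (#) (Suc h) ` ?B n' (Suc h)" if "h < n"
    proof (intro equalityI subsetI)
      fix as assume as: "as \<in> ?B n (Suc h)"
      then obtain a bs where Cons: "as = a # bs"
        using n by (cases as) (auto simp: staircase_def)
      then have bs: "bs \<in> staircase n'" "\<forall>x\<in>set bs. x \<le> a" "a \<le> Suc h"
        using as n by (auto simp: Cons_in_staircase_iff)
      show "as \<in> ?B n h \<union> (#) (Suc h) ` ?B n' (Suc h)"
      proof (cases "a = Suc h")
        case True
        then show ?thesis using Cons bs by blast
      next
        case False
        then have "a \<le> h" using bs by simp
        then have "\<forall>x\<in>set as. x \<le> h" using Cons bs(2) by (simp, meson le_trans)
        then show ?thesis using as by blast
      qed
    next
      fix as assume "as \<in> ?B n h \<union> (#) (Suc h) ` ?B n' (Suc h)"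
      then show "as \<in> ?B n (Suc h)" using n that by (auto simp: Cons_in_staircase_iff le_SucI)
    qed
    have IH1: "card (?B n h) + ((n + h') choose Suc n) = (n + h') choose n"
      using Suc.hyps(1)[of n h'] Suc.hyps(2) Suc.prems \<open>h = Suc h'\<close> by simp
    show ?thesis
    proof (cases "h = n")
      case True
      have "?B n (Suc h) = ?B n h" using staircase_set True by fastforce
      \<comment> \<open>Here \<open>h' = n - 1\<close>; this symmetry and Pascal's rule turn the
        hypothesis for \<open>h'\<close> into the claim.\<close>
      moreover have "(n + h') choose n = (n + h') choose h'"
        using binomial_symmetric[of n "n + h'"] by simp
      ultimately show ?thesis using IH1 True \<open>h = Suc h'\<close> n by simp
    next
      case False
      then have hn: "h < n" using Suc.prems by simp
      have IH2: "card (?B n' (Suc h)) + ((n' + h) choose Suc n') = (n' + h) choose n'"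
        using Suc.hyps(1)[of n' h] Suc.hyps(2) hn n by simp
      have "card (?B n (Suc h)) = card (?B n h) + card ((#) (Suc h) ` ?B n' (Suc h))"
        unfolding split[OF hn] by (rule card_Un_disjoint) auto
      also have "card ((#) (Suc h) ` ?B n' (Suc h)) = card (?B n' (Suc h))"
        by (rule card_image) simp
      \<comment> \<open>Since \<open>n' + h = n + h'\<close>, the sum of the two hypotheses is the
        claim after Pascal's rule on both sides.\<close>
      finally show ?thesis using IH1 IH2 \<open>h = Suc h'\<close> n by simp
    qed
  qed
qed

text \<open>The second coefficient is \<open>n / (n + 1)\<close> times the central one, so the
  difference is the central one divided by \<open>n + 1\<close>.\<close>

lemma catalan_eq_diff: "catalan n = real ((2 * n) choose n) - real ((2 * n) choose Suc n)"
proof -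
  have "Suc n * ((2 * n) choose Suc n) = n * ((2 * n) choose n)"
    using binomial_absorb_comp[of "2 * n" n] binomial_absorption[of n "2 * n"]
    by (metis add_diff_cancel_left' mult_2)
  then have "(real n + 1) * real ((2 * n) choose Suc n) = real n * real ((2 * n) choose n)"
    by (metis Suc_eq_plus1 of_nat_Suc of_nat_mult add.commute)
  then show ?thesis by (simp add: catalan_def field_simps)
qed

lemma card_staircase: "real (card (staircase n)) = catalan n"
proof -
  have "{as \<in> staircase n. \<forall>x\<in>set as. x \<le> Suc n} = staircase n"
    using staircase_set by fastforce
  then show ?thesis
    using card_staircase_bounded[of n n] unfolding catalan_eq_diff
    by (simp add: mult_2 flip: of_nat_add)
qed


section \<open>Exchanging adjacent values\<close>

definition relabel :: "nat \<Rightarrow> nat \<Rightarrow> nat list \<Rightarrow> nat list" where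
  "relabel a b = map (\<lambda>x. if x = a then b else x)"

lemma relabel_relabel: "b \<notin> set as \<Longrightarrow> relabel b a (relabel a b as) = as"
  by (auto simp: relabel_def intro: map_idI)

lemma mem_relabel_iff: "a \<noteq> b \<Longrightarrow>
    x \<in> set (relabel a b as) \<longleftrightarrow> (x = b \<and> a \<in> set as) \<or> (x \<noteq> a \<and> x \<in> set as)"
  by (auto simp: relabel_def)

text \<open>No value lies strictly between \<open>j\<close> and \<open>j + 1\<close>, so merging
  them keeps the order; lowering entries keeps the upper bound.\<close>

lemma relabel_down_in_staircase:
  assumes "as \<in> staircase n" "1 \<le> j"
  shows "relabel (Suc j) j as \<in> staircase n"
  using assms by (fastforce simp: staircase_def relabel_def sorted_wrt_iff_nth_less)

text \<open>Raising an entry \<open>j\<close> at position \<open>i\<close> breaks the bound only if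
  \<open>j + i = n\<close>, that is at position \<open>n - j\<close>.\<close>

lemma relabel_up_in_staircase_iff:
  assumes "as \<in> staircase n" "1 \<le> j" "j \<le> n"
  shows "relabel j (Suc j) as \<in> staircase n \<longleftrightarrow> as ! (n - j) \<noteq> j"
proof -
  have len: "length as = n" using assms by (simp add: staircase_def)
  have bound: "1 \<le> as ! i" "as ! i + i \<le> n" if "i < n" for i
    using assms that by (auto simp: staircase_def)
  have "sorted_wrt (\<ge>) (relabel j (Suc j) as)"
    using assms by (fastforce simp: staircase_def relabel_def sorted_wrt_iff_nth_less)
  moreover have "(\<forall>i<n. 1 \<le> relabel j (Suc j) as ! i \<and> relabel j (Suc j) as ! i + i \<le> n)
      \<longleftrightarrow> as ! (n - j) \<noteq> j"
  proof -
    have "1 \<le> relabel j (Suc j) as ! i \<and> relabel j (Suc j) as ! i + i \<le> n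
        \<longleftrightarrow> (as ! i = j \<longrightarrow> i \<noteq> n - j)" if "i < n" for i
      using bound[OF that] that len assms(3) by (auto simp: relabel_def)
    moreover have "n - j < n" using assms by simp
    ultimately show ?thesis by metis
  qed
  ultimately show ?thesis using len assms by (auto simp: staircase_def relabel_def)
qed

text \<open>
  Cutting at position \<open>n - j\<close> gives the two smaller diagrams. The first \<open>n - j\<close> entries avoid
  \<open>j + 1\<close>, so closing this gap in their values makes room for the staircase of size \<open>n - j\<close>.
\<close>

lemma card_tight_staircase:
  assumes "1 \<le> j" "j \<le> n"
  shows "card {as \<in> staircase n. Suc j \<notin> set as \<and> as ! (n - j) = j}
           = card (staircase (n - j)) * card (staircase (j - 1))"
proof -
  let ?Z = "{as \<in> staircase n. Suc j \<notin> set as \<and> as ! (n - j) = j}"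
  \<comment> \<open>On positive values \<open>?up\<close> is increasing and skips
    \<open>j + 1\<close>: 1 goes to \<open>j\<close>, 2 to \<open>j + 2\<close>, and so on.
    \<open>?down\<close> inverts it.\<close>
  let ?up = "\<lambda>x. if x = 1 then j else x + j" and ?down = "\<lambda>x. if x = j then 1 else x - j"
  let ?glue = "\<lambda>(bs, cs). map ?up bs @ j # cs"
  let ?cut = "\<lambda>as. (map ?down (take (n - j) as), drop (Suc (n - j)) as)"
  have "bij_betw ?glue (staircase (n - j) \<times> staircase (j - 1)) ?Z"
  proof (rule bij_betw_byWitness[where f' = ?cut])
    show "\<forall>p\<in>staircase (n - j) \<times> staircase (j - 1). ?cut (?glue p) = p"
    proof (intro ballI, elim SigmaE, hypsubst)
      fix bs cs assume bs: "bs \<in> staircase (n - j)" and cs: "cs \<in> staircase (j - 1)"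
      have "1 \<le> x" if "x \<in> set bs" for x
        using staircase_set[OF bs] that by auto
      then have "map (?down \<circ> ?up) bs = bs"
        by (intro map_idI) (auto simp: Suc_le_eq)
      moreover have "length bs = n - j" using bs by (simp add: staircase_def)
      ultimately show "?cut (?glue (bs, cs)) = (bs, cs)" by simp
    qed
    show "\<forall>as\<in>?Z. ?glue (?cut as) = as"
    proof
      fix as assume as: "as \<in> ?Z"
      have len: "n - j < length as" using as assms by (simp add: staircase_def)
      have "j \<le> x" if "x \<in> set (take (n - j) as)" for x
        using that as staircase_nth_mono[of as n _ "n - j"] assms
        by (fastforce simp: in_set_conv_nth)
      moreover have "x \<noteq> Suc j" if "x \<in> set (take (n - j) as)" for x
        using that as by (auto dest: in_set_takeD)
      ultimately have "(?up \<circ> ?down) x = x" if "x \<in> set (take (n - j) as)" for x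
        using that by (fastforce simp: le_less)
      then have "map (?up \<circ> ?down) (take (n - j) as) = take (n - j) as"
        by (rule map_idI)
      then show "?glue (?cut as) = as"
        using as id_take_nth_drop[OF len] by simp
    qed
    show "?glue ` (staircase (n - j) \<times> staircase (j - 1)) \<subseteq> ?Z"
    proof clarify
      fix bs cs assume bs: "bs \<in> staircase (n - j)" and cs: "cs \<in> staircase (j - 1)"
      let ?as = "map ?up bs @ j # cs"
      have len: "length bs = n - j" "length cs = j - 1" using bs cs by (auto simp: staircase_def)
      have sb: "set bs \<subseteq> {1..n - j}" and sc: "set cs \<subseteq> {1..j - 1}"
        using staircase_set[OF bs] staircase_set[OF cs] .
      have "sorted_wrt (\<ge>) (map ?up bs)"
        using bs by (fastforce simp: staircase_def sorted_wrt_iff_nth_less)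
      moreover have "\<forall>x\<in>set (map ?up bs). j \<le> x" by auto
      moreover have "\<forall>x\<in>set cs. x \<le> j" using sc by fastforce
      ultimately have "sorted_wrt (\<ge>) ?as"
        using cs by (fastforce simp: sorted_wrt_append staircase_def)
      moreover have "1 \<le> ?as ! i \<and> ?as ! i + i \<le> n" if "i < n" for i
      proof (cases "i < n - j")
        case True
        then have "1 \<le> bs ! i" "bs ! i + i \<le> n - j" using bs by (auto simp: staircase_def)
        then show ?thesis using True len assms by (auto simp: nth_append)
      next
        case False
        show ?thesis
        proof (cases "i = n - j")
          case True
          then show ?thesis using len assms by (simp add: nth_append)
        next
          case ne: False
          \<comment> \<open>\<open>k\<close> is the position within \<open>cs\<close>, after the
            \<open>n - j\<close> raised entries and the separating \<open>j\<close>.\<close>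
          define k where "k = i - Suc (n - j)"
          have k: "i = Suc (n - j + k)" "k < j - 1" using False ne that assms by (auto simp: k_def)
          then have "1 \<le> cs ! k" "cs ! k + k \<le> j - 1" using cs by (auto simp: staircase_def)
          moreover have "?as ! i = cs ! k" using k(1) len by (simp add: nth_append)
          ultimately show ?thesis using k assms by linarith
        qed
      qed
      moreover have "Suc j \<notin> set ?as" using sb sc assms by auto
      ultimately show "?as \<in> staircase n \<and> Suc j \<notin> set ?as \<and> ?as ! (n - j) = j"
        using len assms by (simp add: staircase_def nth_append)
    qed
    show "?cut ` ?Z \<subseteq> staircase (n - j) \<times> staircase (j - 1)"
    proof (rule image_subsetI)
      fix as assume "as \<in> ?Z"
      then have as: "as \<in> staircase n" and eq: "as ! (n - j) = j" by simp_all
      have len: "length as = n" and bound: "\<And>i. i < n \<Longrightarrow> 1 \<le> as ! i \<and> as ! i + i \<le> n"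
        using as by (auto simp: staircase_def)
      have mono: "as ! l \<le> as ! k" if "k < l" "l < n" for k l
        using staircase_nth_mono[OF as, of k l] that by simp
      have ge: "j \<le> as ! i" if "i < n - j" for i
        using mono[of i "n - j"] eq that assms by simp
      have "?down (as ! l) \<le> ?down (as ! k)" if "k < l" "l < n - j" for k l
      proof -
        have "as ! l \<le> as ! k" using mono[of k l] that by linarith
        then show ?thesis using ge[of k] ge[of l] that by auto
      qed
      \<comment> \<open>An entry above \<open>j\<close> drops by \<open>j\<close>, as the bound
        does; an entry \<open>j\<close> becomes 1, which fits because
        \<open>i < n - j\<close>.\<close>
      moreover have "1 \<le> ?down (as ! i) \<and> ?down (as ! i) + i \<le> n - j" if "i < n - j" for i
      proof -
        have "as ! i + i \<le> n" using bound[of i] that by linarith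
        then show ?thesis using ge[of i] that by auto
      qed
      moreover have "map ?down (take (n - j) as) ! i = ?down (as ! i)" if "i < n - j" for i
        using that len by simp
      ultimately have 1: "map ?down (take (n - j) as) \<in> staircase (n - j)"
        using len by (simp add: staircase_def sorted_wrt_iff_nth_less del: nth_map split del: if_split)
      have "1 \<le> as ! (Suc (n - j) + i) \<and> as ! (Suc (n - j) + i) + i \<le> j - 1" if "i < j - 1" for i
      proof -
        have "Suc (n - j) + i < n" using that assms by linarith
        from bound[OF this] show ?thesis using that assms by linarith
      qed
      then have 2: "drop (Suc (n - j)) as \<in> staircase (j - 1)"
        using len assms as by (simp add: staircase_def sorted_wrt_drop)
      show "?cut as \<in> staircase (n - j) \<times> staircase (j - 1)"
        using 1 2 by blast
    qed
  qed
  from bij_betw_same_card[OF this] show ?thesis by (simp only: card_cartesian_product)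
qed

section \<open>The recurrence in \<open>j\<close> and its telescoping\<close>

lemma card_mem_staircase_step:
  assumes "1 \<le> j" "j \<le> n"
  shows "card {as \<in> staircase n. j \<in> set as}
           = card {as \<in> staircase n. Suc j \<in> set as} + card (staircase (n - j)) * card (staircase (j - 1))"
proof -
  let ?F = "\<lambda>j. {as \<in> staircase n. j \<in> set as}"
  let ?X = "{as \<in> staircase n. j \<in> set as \<and> Suc j \<notin> set as}"
  let ?Y = "{as \<in> staircase n. j \<notin> set as \<and> Suc j \<in> set as}"
  let ?Z = "{as \<in> staircase n. Suc j \<notin> set as \<and> as ! (n - j) = j}"
  have Zj: "j \<in> set as" if "as \<in> ?Z" for as
    using that assms nth_mem[of "n - j" as] by (auto simp: staircase_def)
  have bij: "bij_betw (relabel (Suc j) j) ?Y (?X - ?Z)"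
  proof (rule bij_betw_byWitness[where f' = "relabel j (Suc j)"])
    show "relabel (Suc j) j ` ?Y \<subseteq> ?X - ?Z"
    proof (rule image_subsetI)
      fix as assume as: "as \<in> ?Y"
      let ?bs = "relabel (Suc j) j as"
      have bs: "?bs \<in> staircase n" using relabel_down_in_staircase as assms by blast
      \<comment> \<open>Raising the entries back recovers \<open>as\<close>, so \<open>?bs\<close>
        cannot touch the boundary at level \<open>j\<close>.\<close>
      have "relabel j (Suc j) ?bs \<in> staircase n" using relabel_relabel[of j as "Suc j"] as by simp
      then have "?bs ! (n - j) \<noteq> j" using relabel_up_in_staircase_iff[OF bs assms] by simp
      then show "?bs \<in> ?X - ?Z" using bs as by (auto simp: mem_relabel_iff)
    qed
    show "relabel j (Suc j) ` (?X - ?Z) \<subseteq> ?Y"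
      using relabel_up_in_staircase_iff assms by (auto simp: mem_relabel_iff)
  qed (auto simp: relabel_relabel)
  have "card ?X = card ?Y + card ?Z"
  proof -
    have "?Z \<subseteq> ?X" using Zj by auto
    then have "card ?X = card (?X - ?Z) + card ?Z"
      by (simp add: card_Diff_subset card_mono)
    then show ?thesis using bij_betw_same_card[OF bij] by simp
  qed
  \<comment> \<open>Both sides count the diagrams containing \<open>j\<close> or
    \<open>j + 1\<close>.\<close>
  moreover have "card (?F j) + card ?Y = card (?F (Suc j)) + card ?X"
  proof -
    have "card (?F j) + card ?Y = card (?F j \<union> ?Y)" by (rule card_Un_disjoint[symmetric]) auto
    also have "?F j \<union> ?Y = ?F (Suc j) \<union> ?X" by auto
    also have "card \<dots> = card (?F (Suc j)) + card ?X" by (rule card_Un_disjoint) auto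
    finally show ?thesis .
  qed
  ultimately show ?thesis using card_tight_staircase[OF assms] by simp
qed

lemma card_mem_staircase:
  assumes "1 \<le> j" "j \<le> n"
  shows "real (card {as \<in> staircase n. j \<in> set as}) = (\<Sum>k=0..n-j. catalan (n - 1 - k) * catalan k)"
proof -
  \<comment> \<open>With \<open>m = n - j\<close> the recurrence adds exactly the summand for
    \<open>k = m\<close>, so induction on \<open>m\<close> descends from the top value
    \<open>n\<close>.\<close>
  have step: "real (card {as \<in> staircase n. n - m \<in> set as})
      = real (card {as \<in> staircase n. Suc (n - m) \<in> set as}) + catalan (n - 1 - m) * catalan m"
    if "m < n" for m
  proof -
    have "n - (n - m) = m" "n - m - 1 = n - 1 - m" using that by simp_all
    then show ?thesis
      using card_mem_staircase_step[of "n - m" n] that by (simp flip: card_staircase)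
  qed
  have "real (card {as \<in> staircase n. n - m \<in> set as}) = (\<Sum>k=0..m. catalan (n - 1 - k) * catalan k)"
    if "m < n" for m
    using that
  proof (induction m)
    case 0
    have "{as \<in> staircase n. Suc n \<in> set as} = {}" using staircase_set by fastforce
    then have "card {as \<in> staircase n. Suc n \<in> set as} = 0" by (simp only: card.empty)
    then show ?case using step[of 0] 0 by simp
  next
    case (Suc m)
    have "Suc (n - Suc m) = n - m" using Suc.prems by simp
    then show ?case using step[OF Suc.prems] Suc by simp
  qed
  from this[of "n - j"] show ?thesis using assms by simp
qed

theorem theorem4p1:
  fixes n j :: nat
  assumes "n \<ge> 1" and "1 \<le> j" and "j \<le> n"
  shows "real (card {as. parking_function n as \<and> weakly_decreasing as \<and> lucky_spot n as j})
           = (\<Sum>k=0..n-j. catalan (n - 1 - k) * catalan k)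
      \<and> real (card {as. parking_function n as \<and> weakly_decreasing as \<and> lucky_car n as j})
           = (\<Sum>k=0..n-j. catalan (n - 1 - k) * catalan k)
      \<and> (\<Sum>k=0..n-j. catalan (n - 1 - k) * catalan k)
           = (\<Sum>k=0..n-j. 1 / ((real n - real k) * (real k + 1))
                * real ((2 * (n - 1 - k)) choose (n - 1 - k)) * real ((2 * k) choose k))"
proof (intro conjI)
  have "{as. parking_function n as \<and> weakly_decreasing as \<and> lucky_spot n as j}
      = {as \<in> staircase n. j \<in> set as}"
    using decreasing_parking_function_iff lucky_spot_iff by blast
  then show "real (card {as. parking_function n as \<and> weakly_decreasing as \<and> lucky_spot n as j})
      = (\<Sum>k=0..n-j. catalan (n - 1 - k) * catalan k)"
    using card_mem_staircase assms by simp
  have "{as. parking_function n as \<and> weakly_decreasing as \<and> lucky_car n as j}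
      = {as \<in> staircase n. lucky_car n as j}"
    using decreasing_parking_function_iff by blast
  then show "real (card {as. parking_function n as \<and> weakly_decreasing as \<and> lucky_car n as j})
      = (\<Sum>k=0..n-j. catalan (n - 1 - k) * catalan k)"
    using card_mem_staircase card_lucky_car_eq_card_mem assms by simp
  show "(\<Sum>k=0..n-j. catalan (n - 1 - k) * catalan k)
      = (\<Sum>k=0..n-j. 1 / ((real n - real k) * (real k + 1))
          * real ((2 * (n - 1 - k)) choose (n - 1 - k)) * real ((2 * k) choose k))"
  proof (rule sum.cong)
    fix k assume "k \<in> {0..n - j}"
    \<comment> \<open>As \<open>j \<ge> 1\<close>, \<open>k \<le> n - 1\<close> and the truncated
      subtraction is exact.\<close>
    then have "real (n - 1 - k) + 1 = real n - real k" using assms by (simp add: of_nat_diff)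
    then show "catalan (n - 1 - k) * catalan k = 1 / ((real n - real k) * (real k + 1))
        * real ((2 * (n - 1 - k)) choose (n - 1 - k)) * real ((2 * k) choose k)"
      by (simp add: catalan_def)
  qed simp
qed

end
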